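(* Let $G$ be a $(d_1,d_2)$-polynomial graph such that $d_2-d_1<d_1^2$. Then for any $\eta\in(0,1)$ there exists $c>0$ such that for any vertex $v$ of $G$ and any integer $n$: $$\mathrm{Sep}^v_G(n)\ge c\,n^{(1-\eta)\alpha}\quad\text{with}\quad \alpha=\frac{(d_1-1)\left(d_1^2-(d_2-d_1)\right)}{d_1^2d_2}.$$ Moreover, if $d_1=d_2$ the conclusion is also true for $\eta=0$.
   Context: A graph $G$ has vertex set $VG$ and edge set $EG\subset VG\times VG$. For $A\subset VG$, the boundary is $\partial A=\{(a,b)\in EG : \text{exactly one of } a,b \text{ lies in } A\}$. $B_G(v,r)$ is the ball of radius $r$ centred at $v$ for the combinatorial distance. For positive reals $d_1,d_2$, a graph $G$ is $(d_1,d_2)$-polynomial if there exist $b,g>0$ such that: for any vertex $v$ and any positive integer $n$, $|B_G(v,n)|\le b n^{d_2}$; and for any finite nonempty $V\subset VG$, $|\partial V|\ge g|V|^{\frac{d_1-1}{d_1}}$. For a finite graph $H$, the Cheeger constant is $h(H)=\min\{|\partial_H A|/|A| : \emptyset\ne A\subset VH,\ |A|\le |VH|/2\}$, where $\partial_H$ is the boundary in $H$. For a finite $F\subset VG$, $h(F)$ is the Cheeger constant of the subgraph of $G$ induced on $F$. The local separation profile at a vertex $v$ is $\mathrm{Sep}^v_G(n)=\sup\{|F|\,h(F) : F\subset B_G(v,r) \text{ for some } r \text{ with } |B_G(v,r)|\le n\}$.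
   Formalization: "Any integer n" is read as any integer n ≥ |B_G(v,1)|: for smaller n ≥ 1 (e.g. n = 1) the only nonempty F is {v}, whose Cheeger constant is a minimum over the empty set; h of a graph with fewer than two vertices is set to 0, for which the bound fails at n = 1. *)

theory Defs
  imports Complex_Main "Graph_Theory.Graph_Theory"
begin

(* Edges are ordered pairs, so in a symmetric graph every undirected edge between A and its
   complement contributes both of its orientations. *)
definition boundary :: "('a, 'b) pre_digraph \<Rightarrow> 'a set \<Rightarrow> 'b set" where
  "boundary G A = {e \<in> arcs G. (tail G e \<in> A) \<noteq> (head G e \<in> A)}"

(* With all weights 1, the library's path weight infimum is the combinatorial distance
   (infinite between different components). It takes integer or infinite values, so radii in
   nat give all nonempty balls. *)
definition gball :: "('a, 'b) pre_digraph \<Rightarrow> 'a \<Rightarrow> nat \<Rightarrow> 'a set" where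
  "gball G v r = {w \<in> verts G. wf_digraph.\<mu> G (\<lambda>_. 1) v w \<le> ereal (real r)}"

(* Finiteness of balls is part of the growth bound; it must be explicit because card is 0 on
   infinite sets. It also makes G locally finite, so the boundaries below are finite. *)
definition polynomial_graph :: "real \<Rightarrow> real \<Rightarrow> ('a, 'b) pre_digraph \<Rightarrow> bool" where
  "polynomial_graph d1 d2 G \<longleftrightarrow>
     (\<exists>b>0. \<exists>g>0.
        (\<forall>v \<in> verts G. \<forall>n::nat. n \<ge> 1 \<longrightarrow>
           finite (gball G v n) \<and> real (card (gball G v n)) \<le> b * real n powr d2) \<and>
        (\<forall>V. V \<subseteq> verts G \<and> finite V \<and> V \<noteq> {} \<longrightarrow>
           real (card (boundary G V)) \<ge> g * real (card V) powr ((d1 - 1) / d1)))"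

(* For finite H. If H has fewer than two vertices, no set A is admissible; the value is then 0. *)
definition cheeger :: "('a, 'b) pre_digraph \<Rightarrow> real" where
  "cheeger H =
     (if card (verts H) < 2 then 0
      else Min {real (card (boundary H A)) / real (card A) | A.
                  A \<subseteq> verts H \<and> A \<noteq> {} \<and> real (card A) \<le> real (card (verts H)) / 2})"

definition local_sep :: "('a, 'b) pre_digraph \<Rightarrow> 'a \<Rightarrow> nat \<Rightarrow> ereal" where
  "local_sep G v n =
     Sup {ereal (real (card F) * cheeger (G \<restriction> F)) | F.
            \<exists>r. finite (gball G v r) \<and> card (gball G v r) \<le> n \<and> F \<subseteq> gball G v r}"

end

theory Submission
  imports Defs
begin

text \<open>Let q = (d1 - 1) / d1 and fix 0 < u < 1 - q. Among the nonempty subsets of a ball of radius r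
  let F minimise |bd F| / |F|^(1 - u). For A inside F, comparing the ratios of A and F - A with that
  of F, and using the strict concavity of t^(1 - u), shows that |F| h(F) is at least a constant times
  |bd F|, hence at least a constant times |F|^q by the isoperimetric inequality. Since the concentric
  balls have at most b s^d2 elements, one of them has ratio at most a constant times r^(d2 u - 1);
  together with the isoperimetric inequality for F this forces |F| to be at least a constant times
  r^((1 - d2 u) / (1 - u - q)). For u = 1 / (d1 (d1 + 1)) the resulting bound on the separation
  profile is r^(d2 alpha), which is the claim, without any loss in the exponent. If d1 \<le> 1 then
  alpha \<le> 0 and a single edge suffices.\<close>

section \<open>Balls\<close>

text \<open>With unit weights the cost of a walk is its length, so membership in a ball can be
  certified and extended by explicit walks.\<close>

lemma gball_iff_awalk:
  assumes "wf_digraph H"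
  shows "w \<in> gball H v r \<longleftrightarrow> (\<exists>p. pre_digraph.awalk H v p w \<and> length p \<le> r)"
proof -
  interpret wf_digraph H by fact
  have cost: "awalk_cost (\<lambda>_. 1) p = real (length p)" for p
    by (induction p) auto
  show ?thesis
  proof
    assume "w \<in> gball H v r"
    then have "\<mu> (\<lambda>_. 1) v w \<le> ereal (real r)" by (simp add: gball_def)
    \<comment> \<open>A strict bound yields a walk from the infimum; as lengths are integers, length
      below \<open>r + 1\<close> means length at most \<open>r\<close>.\<close>
    also have "\<dots> < ereal (real r + 1)" by simp
    finally obtain p where "awalk v p w" "real (length p) < real r + 1"
      unfolding \<mu>_def by (auto simp: INF_less_iff cost)
    then show "\<exists>p. awalk v p w \<and> length p \<le> r" by (intro exI[of _ p]) auto
  next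
    assume "\<exists>p. awalk v p w \<and> length p \<le> r"
    then obtain p where p: "awalk v p w" "length p \<le> r" by blast
    have "\<mu> (\<lambda>_. 1) v w \<le> ereal (real (length p))"
      using min_cost_le_walk_cost[OF p(1), of "\<lambda>_. 1"] by (simp add: cost)
    also have "\<dots> \<le> ereal (real r)" using p(2) by simp
    finally show "w \<in> gball H v r" using p(1) by (auto simp: gball_def)
  qed
qed

lemma gball_subset_verts: "gball H v r \<subseteq> verts H"
  by (auto simp: gball_def)

lemma gball_mono:
  assumes "wf_digraph H" "r \<le> s"
  shows "gball H v r \<subseteq> gball H v s"
  using assms by (force simp: gball_iff_awalk)

lemma centre_in_gball:
  assumes "wf_digraph H" "v \<in> verts H"
  shows "v \<in> gball H v r"
proof -
  interpret wf_digraph H by fact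
  show ?thesis using assms by (auto simp: gball_iff_awalk awalk_Nil_iff intro!: exI[of _ "[]"])
qed

lemma head_in_gball_Suc:
  assumes "wf_digraph H" "e \<in> arcs H" "tail H e \<in> gball H v r"
  shows "head H e \<in> gball H v (Suc r)"
proof -
  interpret wf_digraph H by fact
  obtain p where p: "awalk v p (tail H e)" "length p \<le> r"
    using assms(3) by (auto simp: gball_iff_awalk[OF assms(1)])
  have "awalk v (p @ [e]) (head H e)"
    using p(1) arc_implies_awalk[OF assms(2)] by (auto intro: awalk_appendI)
  with p(2) show ?thesis
    by (auto simp: gball_iff_awalk[OF assms(1)] intro!: exI[of _ "p @ [e]"])
qed

section \<open>Cheeger constants of induced subgraphs\<close>

lemma cheeger_ge:
  assumes "finite (verts H)" "card (verts H) \<ge> 2"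
    and "\<And>A. A \<subseteq> verts H \<Longrightarrow> A \<noteq> {} \<Longrightarrow> real (card A) \<le> real (card (verts H)) / 2
           \<Longrightarrow> x * real (card A) \<le> real (card (boundary H A))"
  shows "x \<le> cheeger H"
proof -
  let ?adm = "{A. A \<subseteq> verts H \<and> A \<noteq> {} \<and> real (card A) \<le> real (card (verts H)) / 2}"
  let ?S = "(\<lambda>A. real (card (boundary H A)) / real (card A)) ` ?adm"
  have "finite ?S" using assms(1) by auto
  \<comment> \<open>A singleton is admissible because \<open>H\<close> has at least two vertices, so
    \<open>Min\<close> ranges over a nonempty set.\<close>
  moreover from assms(2) obtain v where "v \<in> verts H" by fastforce
  then have "{v} \<in> ?adm" using assms(2) by auto
  then have "?S \<noteq> {}" by blast
  moreover have "x \<le> y" if "y \<in> ?S" for y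
  proof -
    from that obtain A where A: "A \<in> ?adm" "y = real (card (boundary H A)) / real (card A)"
      by blast
    then have "card A > 0" using assms(1) by (auto simp: card_gt_0_iff intro: finite_subset)
    then show ?thesis using assms(3)[of A] A by (simp add: pos_le_divide_eq)
  qed
  ultimately have "x \<le> Min ?S" by simp
  also have "?S = {real (card (boundary H A)) / real (card A) | A. A \<in> ?adm}" by blast
  finally show ?thesis using assms(2) by (simp add: cheeger_def)
qed

text \<open>An arc in both boundaries on the left joins \<open>A\<close> to \<open>F - A\<close>,
  hence is cut by \<open>A\<close> inside \<open>F\<close>; an arc in only one of them leaves or
  enters \<open>F\<close>. So inner arcs count twice and outer arcs once.\<close>

lemma card_boundary_split:
  assumes "A \<subseteq> F" "finite (boundary H A)" "finite (boundary H (F - A))" "finite (boundary H F)"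
  shows "card (boundary H A) + card (boundary H (F - A))
           \<le> card (boundary H F) + 2 * card (boundary (H \<restriction> F) A)"
proof -
  have "boundary H A \<inter> boundary H (F - A) \<subseteq> boundary (H \<restriction> F) A"
    and fin: "boundary (H \<restriction> F) A \<subseteq> boundary H A"
    and "boundary H A \<union> boundary H (F - A) \<subseteq> boundary H F \<union> boundary (H \<restriction> F) A"
    using assms(1) by (auto simp: boundary_def)
  moreover have "finite (boundary (H \<restriction> F) A)" using fin assms(2) by (rule finite_subset)
  ultimately have "card (boundary H A \<inter> boundary H (F - A)) \<le> card (boundary (H \<restriction> F) A)"
    and "card (boundary H A \<union> boundary H (F - A)) \<le> card (boundary H F \<union> boundary (H \<restriction> F) A)"
    using assms by (auto intro!: card_mono)
  moreover have "card (boundary H F \<union> boundary (H \<restriction> F) A)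
      \<le> card (boundary H F) + card (boundary (H \<restriction> F) A)" by (rule card_Un_le)
  ultimately show ?thesis using card_Un_Int[OF assms(2,3)] by linarith
qed

text \<open>Quantitative strict concavity: \<open>(2 * t) powr u\<close> is at most 1, so
  \<open>t powr (1 - u)\<close> is at least \<open>2 powr u * t\<close>, while the other term is at
  least \<open>1 - t\<close>. The gain is linear in \<open>t\<close>, as a Cheeger quotient
  requires.\<close>

lemma powr_split_ge:
  fixes t u :: real
  assumes "0 < t" "t \<le> 1/2" "0 < u" "u < 1"
  shows "1 + (2 powr u - 1) * t \<le> t powr (1 - u) + (1 - t) powr (1 - u)"
proof -
  have "2 powr u * t powr u = (2 * t) powr u" using assms by (simp add: powr_mult)
  also have "\<dots> \<le> 1" using assms by (intro powr_le1) auto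
  finally have "2 powr u * t powr u * t powr (1 - u) \<le> 1 * t powr (1 - u)"
    by (intro mult_right_mono) auto
  then have "2 powr u * t \<le> t powr (1 - u)"
    using assms by (simp add: mult.assoc flip: powr_add)
  moreover have "(1 - t) powr 1 \<le> (1 - t) powr (1 - u)"
    using assms by (intro powr_mono') auto
  ultimately show ?thesis using assms by (simp add: algebra_simps)
qed

text \<open>The ratios of \<open>A\<close> and \<open>F - A\<close> are at least the ratio
  \<open>m\<close> of \<open>F\<close>. Since the power is strictly subadditive, their boundaries
  together exceed that of \<open>F\<close> by an amount proportional to the share of
  \<open>A\<close> in \<open>F\<close>, and this excess must come from arcs inside
  \<open>F\<close>.\<close>

lemma cheeger_of_powr_minimiser:
  fixes m u :: real
  assumes u: "0 < u" "u < 1" and F: "finite F" "card F \<ge> 2" "verts H \<inter> F = F"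
    and m: "m \<ge> 0" "real (card (boundary H F)) = m * real (card F) powr (1 - u)"
    and min: "\<And>A. A \<subseteq> F \<Longrightarrow> A \<noteq> {} \<Longrightarrow> m * real (card A) powr (1 - u) \<le> real (card (boundary H A))"
    and fin: "\<And>A. A \<subseteq> F \<Longrightarrow> finite (boundary H A)"
  shows "(2 powr u - 1) / 2 * real (card (boundary H F)) \<le> real (card F) * cheeger (H \<restriction> F)"
proof -
  define N where "N = real (card F)"
  define c where "c = (2 powr u - 1) / 2"
  have N: "N \<ge> 2" using F by (simp add: N_def)
  have "c * real (card (boundary H F)) / N \<le> cheeger (H \<restriction> F)"
  proof (rule cheeger_ge)
    fix A assume "A \<subseteq> verts (H \<restriction> F)" and ne: "A \<noteq> {}"
      and half: "real (card A) \<le> real (card (verts (H \<restriction> F))) / 2"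
    then have A: "A \<subseteq> F" by simp
    define a where "a = real (card A)"
    have a: "0 < a" "a \<le> N / 2"
      using ne A F half finite_subset[OF A] by (auto simp: a_def N_def card_gt_0_iff)
    have Nma: "real (card (F - A)) = N - a"
      using A F by (simp add: N_def a_def card_Diff_subset finite_subset of_nat_diff card_mono)
    have ne': "F - A \<noteq> {}"
    proof
      assume "F - A = {}"
      then have "N - a = 0" using Nma by (metis card.empty of_nat_0)
      then show False using a N by simp
    qed
    define t where "t = a / N"
    have t: "0 < t" "t \<le> 1/2" "a = t * N" "N - a = (1 - t) * N"
      using a N by (auto simp: t_def field_simps)
    have "2 * c * t * (m * N powr (1 - u)) = ((2 powr u - 1) * t) * (m * N powr (1 - u))"
      by (simp add: c_def)
    also have "\<dots> \<le> (t powr (1 - u) + (1 - t) powr (1 - u) - 1) * (m * N powr (1 - u))"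
      using powr_split_ge[OF t(1,2) u] m(1) by (intro mult_right_mono) auto
    also have "\<dots> = m * a powr (1 - u) + m * (N - a) powr (1 - u) - m * N powr (1 - u)"
    proof -
      have "a powr (1 - u) = t powr (1 - u) * N powr (1 - u)"
        and "(N - a) powr (1 - u) = (1 - t) powr (1 - u) * N powr (1 - u)"
        using N t by (auto simp only: powr_mult)
      then show ?thesis by (simp add: algebra_simps)
    qed
    also have "\<dots> \<le> real (card (boundary H A)) + real (card (boundary H (F - A)))
        - real (card (boundary H F))"
      using min[OF A ne] min[of "F - A"] ne' Nma m(2) by (simp add: a_def N_def)
    also have "\<dots> \<le> 2 * real (card (boundary (H \<restriction> F) A))"
      using card_boundary_split[OF A fin[OF A] fin[of "F - A"] fin[of F]] by fastforce
    finally have "c * t * (m * N powr (1 - u)) \<le> real (card (boundary (H \<restriction> F) A))" by simp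
    then show "c * real (card (boundary H F)) / N * real (card A) \<le> real (card (boundary (H \<restriction> F) A))"
      unfolding m(2) by (simp add: t_def a_def N_def mult_ac)
  qed (use F in auto)
  then show ?thesis using N by (simp add: field_simps c_def N_def)
qed

section \<open>Growth of sequences\<close>

text \<open>The derivative of \<open>x powr u\<close> is \<open>u * x powr (u - 1)\<close>, which
  cancels the factor \<open>x powr (1 - u)\<close> of the increment. Hence each step raises the
  \<open>u\<close>-th power by a constant.\<close>

lemma powr_increment_ge:
  fixes x y \<kappa> u :: real
  assumes "x \<ge> 1" "0 < \<kappa>" "\<kappa> \<le> 1" "0 < u" "u < 1" "x + \<kappa> * x powr (1 - u) \<le> y"
  shows "x powr u + u * \<kappa> * 2 powr (u - 1) \<le> y powr u"
proof -
  \<comment> \<open>The least value allowed for \<open>y\<close>. It is at most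
    \<open>2 * x\<close>, so replacing the intermediate point of the mean value theorem by
    \<open>2 * x\<close> costs only the factor \<open>2 powr (u - 1)\<close>.\<close>
  define z where "z = x + \<kappa> * x powr (1 - u)"
  have "x powr (1 - u) \<le> x powr 1" using assms by (intro powr_mono) auto
  then have "\<kappa> * x powr (1 - u) \<le> 1 * x" using assms by (intro mult_mono) auto
  then have z: "x < z" "z \<le> 2 * x" using assms by (auto simp: z_def)
  have "\<exists>\<xi>>x. \<xi> < z \<and> z powr u - x powr u = (z - x) * (u * \<xi> powr (u - 1))"
    using z assms by (intro MVT2 has_real_derivative_powr) auto
  then obtain \<xi> where \<xi>: "x < \<xi>" "\<xi> < z"
    "z powr u - x powr u = (z - x) * (u * \<xi> powr (u - 1))" by blast
  have "2 powr (u - 1) * x powr (u - 1) = (2 * x) powr (u - 1)"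
    using assms by (simp add: powr_mult)
  also have "\<dots> \<le> \<xi> powr (u - 1)" using \<xi> z assms by (intro powr_mono2') auto
  finally have le: "2 powr (u - 1) * x powr (u - 1) \<le> \<xi> powr (u - 1)" .
  have "x powr (1 - u) * x powr (u - 1) = 1" using assms by (simp flip: powr_add)
  then have "u * \<kappa> * 2 powr (u - 1) = (z - x) * (u * (2 powr (u - 1) * x powr (u - 1)))"
    by (simp add: z_def algebra_simps)
  also have "\<dots> \<le> (z - x) * (u * \<xi> powr (u - 1))"
    using le z assms by (intro mult_left_mono) auto
  finally have "x powr u + u * \<kappa> * 2 powr (u - 1) \<le> z powr u" using \<xi>(3) by simp
  also have "\<dots> \<le> y powr u" using assms z unfolding z_def by (intro powr_mono2) auto
  finally show ?thesis .
qed

text \<open>Discrete form of the differential inequality V' \<ge> \<kappa> V^(1 - u), which forces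
  growth of order at least r^(1/u).\<close>

lemma powr_growth:
  fixes V :: "nat \<Rightarrow> real"
  assumes "\<And>s. V s \<ge> 1" "0 < \<kappa>" "\<kappa> \<le> 1" "0 < u" "u < 1"
    and "\<And>s. s < r \<Longrightarrow> V s + \<kappa> * V s powr (1 - u) \<le> V (Suc s)"
  shows "real r * (u * \<kappa> * 2 powr (u - 1)) \<le> V r powr u"
  using assms(6)
proof (induction r)
  case (Suc r)
  have "V r powr u + u * \<kappa> * 2 powr (u - 1) \<le> V (Suc r) powr u"
    using Suc.prems assms by (intro powr_increment_ge) auto
  with Suc show ?case by (simp add: algebra_simps)
qed simp

section \<open>Polynomial graphs\<close>

text \<open>Fixes witnesses \<open>b\<close> and \<open>g\<close> of polynomiality, so that later
  constants can depend on them but not on the vertex, the radius or \<open>n\<close>.\<close>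

locale isoperimetric_graph =
  fixes G :: "'a pair_pre_digraph" and b g d1 d2 :: real
  assumes sym: "pair_sym_digraph G"
    and d1: "0 < d1" and b: "0 < b" and g: "0 < g"
    and ball: "\<And>v n. v \<in> pverts G \<Longrightarrow> n \<ge> 1 \<Longrightarrow>
        finite (gball G v n) \<and> real (card (gball G v n)) \<le> b * real n powr d2"
    and iso: "\<And>V. V \<subseteq> pverts G \<Longrightarrow> finite V \<Longrightarrow> V \<noteq> {} \<Longrightarrow>
        g * real (card V) powr ((d1 - 1) / d1) \<le> real (card (boundary G V))"
begin

interpretation pair_sym_digraph G by (rule sym)

section \<open>Local finiteness, boundaries and growth of balls\<close>

lemma wf: "wf_digraph (with_proj G)"
  by unfold_locales

lemma sym_arc: "(x, y) \<in> parcs G \<Longrightarrow> (y, x) \<in> parcs G"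
  by (rule arcs_symmetric)

lemma finite_gball: "v \<in> pverts G \<Longrightarrow> finite (gball G v n)"
  using ball[of v "max 1 n"] gball_mono[OF wf, of n "max 1 n" v] by (auto intro: finite_subset)

lemma neighbour_in_gball:
  assumes "(x, y) \<in> parcs G" "x \<in> gball G v s"
  shows "y \<in> gball G v (Suc s)"
  using head_in_gball_Suc[OF wf, of "(x, y)" v s] assms by simp

text \<open>Arcs are ordered pairs, so an arc at \<open>v\<close> is determined by its direction and
  its other end, which lies in the unit ball; that ball has at most \<open>b\<close>
  elements.\<close>

lemma arcs_at_vertex:
  assumes v: "v \<in> pverts G"
  shows "finite {e \<in> parcs G. fst e = v \<or> snd e = v}"
    and "real (card {e \<in> parcs G. fst e = v \<or> snd e = v}) \<le> 2 * b"
proof -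
  let ?B = "gball G v 1"
  have sub: "{e \<in> parcs G. fst e = v \<or> snd e = v} \<subseteq> Pair v ` ?B \<union> (\<lambda>w. (w, v)) ` ?B"
    using neighbour_in_gball[of v _ v 0] centre_in_gball[OF wf, of v 0] v sym_arc by auto
  have fin: "finite ?B" using finite_gball[OF v] .
  then show "finite {e \<in> parcs G. fst e = v \<or> snd e = v}"
    using sub by (auto intro: finite_subset)
  have "card {e \<in> parcs G. fst e = v \<or> snd e = v} \<le> card (Pair v ` ?B \<union> (\<lambda>w. (w, v)) ` ?B)"
    using sub fin by (intro card_mono) auto
  also have "\<dots> \<le> card (Pair v ` ?B) + card ((\<lambda>w. (w, v)) ` ?B)" by (rule card_Un_le)
  also have "\<dots> \<le> card ?B + card ?B" using fin by (intro add_mono card_image_le)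
  finally show "real (card {e \<in> parcs G. fst e = v \<or> snd e = v}) \<le> 2 * b"
    using ball[OF v, of 1] by simp
qed

text \<open>The degree bound is summed over any set \<open>W\<close> meeting every boundary arc.
  \<open>W\<close> may lie inside \<open>A\<close> or outside it, as is needed for spheres around
  balls.\<close>

lemma boundary_covered:
  assumes "W \<subseteq> pverts G" "finite W"
    and "\<And>e. e \<in> boundary G A \<Longrightarrow> fst e \<in> W \<or> snd e \<in> W"
  shows "finite (boundary G A)" and "real (card (boundary G A)) \<le> 2 * b * real (card W)"
proof -
  let ?S = "\<lambda>w. {e \<in> parcs G. fst e = w \<or> snd e = w}"
  have sub: "boundary G A \<subseteq> (\<Union>w\<in>W. ?S w)"
    using assms(3) by (fastforce simp: boundary_def)
  have fin: "finite (\<Union>w\<in>W. ?S w)" using assms arcs_at_vertex(1) by blast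
  then show "finite (boundary G A)" using sub by (rule finite_subset[rotated])
  have "card (boundary G A) \<le> (\<Sum>w\<in>W. card (?S w))"
    using card_mono[OF fin sub] card_UN_le[OF assms(2), of ?S] by linarith
  then have "real (card (boundary G A)) \<le> (\<Sum>w\<in>W. real (card (?S w)))"
    by (simp flip: of_nat_sum)
  also have "\<dots> \<le> (\<Sum>w\<in>W. 2 * b)" using assms arcs_at_vertex(2) by (intro sum_mono) auto
  finally show "real (card (boundary G A)) \<le> 2 * b * real (card W)" by (simp add: mult.commute)
qed

lemma finite_boundary:
  assumes "A \<subseteq> pverts G" "finite A"
  shows "finite (boundary G A)"
  by (rule boundary_covered(1)[OF assms]) (auto simp: boundary_def)

lemma boundary_pos:
  assumes "A \<subseteq> pverts G" "finite A" "A \<noteq> {}"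
  shows "real (card (boundary G A)) > 0"
proof -
  have "0 < g * real (card A) powr ((d1 - 1) / d1)" using assms g by (simp add: card_gt_0_iff)
  also have "\<dots> \<le> real (card (boundary G A))" by (rule iso[OF assms])
  finally show ?thesis .
qed

text \<open>Every boundary arc of a ball has an end in the next sphere, by symmetry also when it
  points inwards. A large boundary therefore forces growth.\<close>

lemma card_boundary_gball:
  assumes "v \<in> pverts G"
  shows "real (card (boundary G (gball G v s)))
    \<le> 2 * b * (real (card (gball G v (Suc s))) - real (card (gball G v s)))"
proof -
  let ?W = "gball G v (Suc s) - gball G v s"
  have mono: "gball G v s \<subseteq> gball G v (Suc s)" by (rule gball_mono[OF wf]) simp
  have "real (card (boundary G (gball G v s))) \<le> 2 * b * real (card ?W)"
  proof (rule boundary_covered(2))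
    show "?W \<subseteq> pverts G" using gball_subset_verts[of G] by auto
    show "finite ?W" using finite_gball[OF assms] by auto
    show "fst e \<in> ?W \<or> snd e \<in> ?W" if "e \<in> boundary G (gball G v s)" for e
      using that neighbour_in_gball[of "fst e" "snd e"] neighbour_in_gball[of "snd e" "fst e"] sym_arc
      by (cases e) (auto simp: boundary_def)
  qed
  also have "real (card ?W) = real (card (gball G v (Suc s))) - real (card (gball G v s))"
    using mono finite_gball[OF assms]
    by (simp add: card_Diff_subset of_nat_diff card_mono)
  finally show ?thesis .
qed

text \<open>By the isoperimetric inequality each ball has a nonempty boundary, so the next ball is
  strictly larger.\<close>

lemma card_gball_ge:
  assumes "v \<in> pverts G"
  shows "s < card (gball G v s)"
proof (induction s)
  case 0
  show ?case using centre_in_gball[OF wf, of v 0] assms finite_gball[OF assms]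
    by (auto simp: card_gt_0_iff)
next
  case (Suc s)
  have "0 < real (card (boundary G (gball G v s)))"
    using centre_in_gball[OF wf, of v s] assms finite_gball[OF assms] gball_subset_verts[of G]
    by (intro boundary_pos) auto
  also note card_boundary_gball[OF assms]
  finally have "card (gball G v s) < card (gball G v (Suc s))"
    using b by (simp add: zero_less_mult_iff)
  then show ?case using Suc by simp
qed

section \<open>Witness sets for the separation profile\<close>

lemma local_sep_ge:
  assumes "v \<in> pverts G" "card (gball G v r) \<le> n" "F \<subseteq> gball G v r"
    and "x \<le> real (card F) * cheeger (G \<restriction> F)"
  shows "ereal x \<le> local_sep G v n"
proof -
  have "ereal x \<le> ereal (real (card F) * cheeger (G \<restriction> F))" using assms by simp
  also have "\<dots> \<le> local_sep G v n"
    unfolding local_sep_def using assms finite_gball by (intro Sup_upper) auto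
  finally show ?thesis .
qed

text \<open>The isoperimetric inequality for \<open>{v}\<close> gives a neighbour \<open>w\<close>
  other than \<open>v\<close>. In the subgraph induced on the two, an admissible set is a single
  vertex and is cut by the arc \<open>(v, w)\<close>.\<close>

lemma local_sep_ge_1:
  assumes v: "v \<in> pverts G" and n: "card (gball G v 1) \<le> n"
  shows "1 \<le> local_sep G v n"
proof -
  have "boundary G {v} \<noteq> {}" using boundary_pos[of "{v}"] v by auto
  then obtain w where w: "(v, w) \<in> parcs G" "w \<noteq> v"
    using sym_arc by (auto simp: boundary_def split: if_splits)
  let ?F = "{v, w}" let ?H = "with_proj G \<restriction> ?F"
  have "1 \<le> cheeger ?H"
  proof (rule cheeger_ge)
    fix A assume A: "A \<subseteq> verts ?H" "A \<noteq> {}" "real (card A) \<le> real (card (verts ?H)) / 2"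
    then have "real (card A) \<le> 1" using w(2) by simp
    then have card: "card A \<le> 1" by simp
    have "A = {v} \<or> A = {w}"
    proof (rule ccontr)
      assume "\<not> ?thesis"
      then have "A = {v, w}" using A by auto
      then show False using card w(2) by simp
    qed
    then have "(v, w) \<in> boundary ?H A" using w by (auto simp: boundary_def)
    moreover have "finite (boundary ?H A)"
      by (rule finite_subset[of _ "?F \<times> ?F"]) (auto simp: boundary_def)
    ultimately have "card (boundary ?H A) \<ge> 1"
      by (metis One_nat_def Suc_leI card_gt_0_iff empty_iff)
    then show "1 * real (card A) \<le> real (card (boundary ?H A))" using card by simp
  qed (use w in auto)
  then have "1 \<le> real (card ?F) * cheeger ?H" using w(2) by simp
  moreover have "?F \<subseteq> gball G v 1"
    using centre_in_gball[OF wf, of v] v neighbour_in_gball[OF w(1), of v 0] by simp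
  ultimately show ?thesis using local_sep_ge[OF v n] by (metis one_ereal_def)
qed

text \<open>The bound on m: concentric balls compete in the minimisation of |bd F| / |F|^(1 - u) over
  subsets of the ball, and if all their ratios were large, they would grow too fast.\<close>

lemma powr_minimiser:
  assumes v: "v \<in> pverts G" and r: "r \<ge> 1" and u: "0 < u" "u < 1"
  obtains F m where "F \<subseteq> gball G v r" "F \<noteq> {}" "m > 0"
    "real (card (boundary G F)) = m * real (card F) powr (1 - u)"
    "\<And>A. A \<subseteq> F \<Longrightarrow> A \<noteq> {} \<Longrightarrow> m * real (card A) powr (1 - u) \<le> real (card (boundary G A))"
    "m \<le> b powr u * 2 * b * 2 powr (1 - u) / u * real r powr (d2 * u - 1)"
proof -
  define B where "B = gball G v"
  have finB: "finite (B s)" for s unfolding B_def by (rule finite_gball[OF v])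
  have vB: "v \<in> B s" for s using centre_in_gball[OF wf, of v s] v by (simp add: B_def)
  have BV: "B s \<subseteq> pverts G" for s using gball_subset_verts[of G] by (simp add: B_def)
  define \<phi> where "\<phi> A = real (card (boundary G A)) / real (card A) powr (1 - u)" for A
  let ?S = "Pow (B r) - {{}}"
  obtain F where F: "F \<in> ?S" "\<And>A. A \<in> ?S \<Longrightarrow> \<phi> F \<le> \<phi> A"
  proof
    have S: "finite ?S" "?S \<noteq> {}" using finB vB[of r] by auto
    show "arg_min_on \<phi> ?S \<in> ?S" by (rule arg_min_if_finite(1)[OF S])
    show "\<phi> (arg_min_on \<phi> ?S) \<le> \<phi> A" if "A \<in> ?S" for A by (rule arg_min_least[OF S that])
  qed
  define m where "m = \<phi> F"
  have pos: "card A > 0" if "A \<in> ?S" for A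
    using that finB[of r] by (auto simp: card_gt_0_iff intro: finite_subset)
  have le: "m * real (card A) powr (1 - u) \<le> real (card (boundary G A))" if "A \<in> ?S" for A
    using F(2)[OF that] pos[OF that] by (simp add: m_def \<phi>_def field_simps)
  have eq: "real (card (boundary G F)) = m * real (card F) powr (1 - u)"
    using pos[OF F(1)] by (simp add: m_def \<phi>_def)
  have "0 < real (card (boundary G F))"
    using F(1) BV[of r] finB[of r] by (intro boundary_pos) (auto intro: finite_subset)
  then have m: "m > 0" using eq by (simp add: zero_less_mult_iff)
  \<comment> \<open>Comparison with a single vertex gives the bound on \<open>m / (2 * b)\<close>
    that \<open>powr_growth\<close> requires of its parameter \<kappa>.\<close>
  have "m \<le> real (card (boundary G {v}))" using le[of "{v}"] vB by simp
  also have "\<dots> \<le> 2 * b * real (card {v})"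
    using v by (intro boundary_covered(2)) (auto simp: boundary_def)
  finally have m1: "m / (2 * b) \<le> 1" using b by simp
  define V where "V s = real (card (B s))" for s
  have V1: "V s \<ge> 1" for s using card_gball_ge[OF v, of s] by (simp add: V_def B_def)
  have "real r * (u * (m / (2 * b)) * 2 powr (u - 1)) \<le> V r powr u"
  proof (rule powr_growth)
    fix s assume "s < r"
    then have "B s \<in> ?S" using gball_mono[OF wf, of s r v] vB[of s] by (auto simp: B_def)
    then have "m * V s powr (1 - u) \<le> 2 * b * (V (Suc s) - V s)"
      using le[of "B s"] card_boundary_gball[OF v, of s] by (simp add: V_def B_def)
    then show "V s + m / (2 * b) * V s powr (1 - u) \<le> V (Suc s)"
      using b by (simp add: field_simps)
  qed (use V1 m b m1 u in auto)
  also have "\<dots> \<le> (b * real r powr d2) powr u"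
    using ball[OF v r] u by (intro powr_mono2) (auto simp: V_def B_def)
  also have "\<dots> = b powr u * real r powr (d2 * u)"
    using b r by (simp add: powr_mult powr_powr)
  finally have *: "real r * (u * (m / (2 * b)) * 2 powr (u - 1)) \<le> b powr u * real r powr (d2 * u)" .
  \<comment> \<open>Solves the growth estimate for \<open>m\<close>: the last factor is the
    reciprocal of the coefficient of \<open>m\<close>.\<close>
  have "m = real r * (u * (m / (2 * b)) * 2 powr (u - 1)) * (2 * b * 2 powr (1 - u) / u / real r)"
    using r b u by (simp add: field_simps powr_diff)
  also have "\<dots> \<le> b powr u * real r powr (d2 * u) * (2 * b * 2 powr (1 - u) / u / real r)"
    using * r b u by (intro mult_right_mono) auto
  also have "\<dots> = b powr u * 2 * b * 2 powr (1 - u) / u * real r powr (d2 * u - 1)"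
    using r by (simp add: powr_diff)
  finally have bound: "m \<le> b powr u * 2 * b * 2 powr (1 - u) / u * real r powr (d2 * u - 1)" .
  show ?thesis
  proof (rule that[OF _ _ m eq _ bound])
    fix A assume "A \<subseteq> F" "A \<noteq> {}"
    then show "m * real (card A) powr (1 - u) \<le> real (card (boundary G A))"
      using F(1) by (intro le) auto
  qed (use F in \<open>auto simp: B_def\<close>)
qed

text \<open>Isoperimetry bounds the boundary of the minimiser below by a power \<open>q\<close> of
  its size, and its small ratio bounds it above by a power \<open>1 - u\<close>. As
  \<open>1 - u\<close> exceeds \<open>q\<close>, the two together bound its size from below.\<close>

lemma local_sep_ge_powr_radius:
  assumes q: "q = (d1 - 1) / d1" "q \<ge> 0" and u: "0 < u" "u < 1 - q"
  obtains c where "c > 0"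
    "\<And>v r n. v \<in> pverts G \<Longrightarrow> r \<ge> 1 \<Longrightarrow> card (gball G v r) \<le> n \<Longrightarrow>
      ereal (c * real r powr (q * (1 - d2 * u) / (1 - u - q))) \<le> local_sep G v n"
proof
  define C where "C = b powr u * 2 * b * 2 powr (1 - u) / u"
  \<comment> \<open>The minimum with 1 covers a minimiser consisting of one vertex.\<close>
  define c1 where "c1 = min 1 ((2 powr u - 1) / 2 * g)"
  \<comment> \<open>Chosen to turn the exponent \<open>1 - u - q\<close> of \<open>N\<close> into
    \<open>q\<close>.\<close>
  define \<gamma> where "\<gamma> = q / (1 - u - q)"
  have C: "C > 0" using b u by (simp add: C_def)
  have "2 powr u > 1" using u by (intro gr_one_powr) auto
  then have c1: "c1 > 0" using g by (simp add: c1_def)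
  show "c1 * (g / C) powr \<gamma> > 0" using c1 g C by simp
  fix v r n assume v: "v \<in> pverts G" and r: "r \<ge> (1::nat)" and n: "card (gball G v r) \<le> n"
  have u1: "u < 1" using u q by linarith
  obtain F m where F: "F \<subseteq> gball G v r" "F \<noteq> {}" "m > 0"
    and eq: "real (card (boundary G F)) = m * real (card F) powr (1 - u)"
    and min: "\<And>A. A \<subseteq> F \<Longrightarrow> A \<noteq> {} \<Longrightarrow> m * real (card A) powr (1 - u) \<le> real (card (boundary G A))"
    and m: "m \<le> C * real r powr (d2 * u - 1)"
    using powr_minimiser[OF v r u(1) u1] unfolding C_def by metis
  have fin: "finite F" using F(1) finite_gball[OF v] by (rule finite_subset)
  have FV: "F \<subseteq> pverts G" using F(1) gball_subset_verts[of G] by auto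
  define N where "N = real (card F)"
  have N: "N \<ge> 1" using fin F(2) by (simp add: N_def Suc_leI card_gt_0_iff)
  have isoF: "g * N powr q \<le> real (card (boundary G F))"
    using iso[OF FV fin F(2)] by (simp add: N_def q(1))
  also have "\<dots> \<le> C * real r powr (d2 * u - 1) * N powr (1 - u)"
    unfolding eq N_def by (intro mult_right_mono m) simp
  finally have "g / C * real r powr (1 - d2 * u) \<le> N powr (1 - u - q)"
    using C r N by (simp add: field_simps powr_diff powr_add)
  moreover have "\<gamma> \<ge> 0" using q(2) u by (simp add: \<gamma>_def)
  ultimately have "(g / C * real r powr (1 - d2 * u)) powr \<gamma> \<le> (N powr (1 - u - q)) powr \<gamma>"
    using g C by (intro powr_mono2) auto
  then have Nq: "(g / C) powr \<gamma> * real r powr (q * (1 - d2 * u) / (1 - u - q)) \<le> N powr q"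
    using u unfolding powr_mult powr_powr by (simp add: \<gamma>_def mult.commute)
  have "ereal (c1 * N powr q) \<le> local_sep G v n"
  proof (cases "card F \<ge> 2")
    case True
    have "c1 * N powr q \<le> (2 powr u - 1) / 2 * g * N powr q"
      by (intro mult_right_mono) (auto simp: c1_def)
    also have "\<dots> \<le> (2 powr u - 1) / 2 * real (card (boundary G F))"
      using isoF \<open>2 powr u > 1\<close> by (simp add: mult_left_mono mult.assoc)
    also have "\<dots> \<le> real (card F) * cheeger (G \<restriction> F)"
    proof (rule cheeger_of_powr_minimiser[OF u(1) u1 fin True _ _ eq min])
      show "finite (boundary G A)" if "A \<subseteq> F" for A
        using that FV fin by (intro finite_boundary) (auto intro: finite_subset)
    qed (use FV F in auto)
    finally show ?thesis using local_sep_ge[OF v n F(1)] by blast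
  next
    \<comment> \<open>The Cheeger constant of a single vertex is 0 by convention, so an edge in the
      unit ball replaces \<open>F\<close> as witness.\<close>
    case False
    then have "N = 1" using N by (simp add: N_def)
    then have "c1 * N powr q \<le> 1" by (simp add: c1_def)
    then have "ereal (c1 * N powr q) \<le> 1" by simp
    also have "1 \<le> local_sep G v n"
    proof (rule local_sep_ge_1[OF v])
      have "card (gball G v 1) \<le> card (gball G v r)"
        using gball_mono[OF wf r] finite_gball[OF v] by (intro card_mono) auto
      then show "card (gball G v 1) \<le> n" using n by linarith
    qed
    finally show ?thesis .
  qed
  moreover have "c1 * (g / C) powr \<gamma> * real r powr (q * (1 - d2 * u) / (1 - u - q)) \<le> c1 * N powr q"
    using Nq c1 by (simp add: mult.assoc)
  ultimately show "ereal (c1 * (g / C) powr \<gamma> * real r powr (q * (1 - d2 * u) / (1 - u - q)))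
      \<le> local_sep G v n" by (meson ereal_less_eq(3) order_trans)
qed

section \<open>Passage from the radius to the cardinality of balls\<close>

text \<open>A largest admissible radius exists since a ball of radius \<open>r\<close> has more than
  \<open>r\<close> elements. Its maximality is what lets the upper growth bound give a lower bound
  on \<open>r\<close> in terms of \<open>n\<close>.\<close>

lemma radius_of_cardinality:
  assumes v: "v \<in> pverts G" and n: "card (gball G v 1) \<le> n"
  obtains r where "r \<ge> 1" "card (gball G v r) \<le> n" "n < card (gball G v (Suc r))"
proof -
  let ?P = "\<lambda>r. card (gball G v r) \<le> n"
  have bnd: "\<forall>r. ?P r \<longrightarrow> r \<le> n" using card_gball_ge[OF v] by (meson le_trans less_imp_le)
  define r where "r = (GREATEST r. ?P r)"
  have "?P r" unfolding r_def using GreatestI_nat[of ?P 1 n] n bnd by blast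
  moreover have "r \<ge> 1" unfolding r_def using Greatest_le_nat[of ?P 1 n] n bnd by blast
  moreover have "\<not> ?P (Suc r)"
  proof
    assume "?P (Suc r)"
    then have "Suc r \<le> (GREATEST r. ?P r)"
      by (rule Greatest_le_nat[of ?P "Suc r" n]) (use bnd in blast)
    then show False by (simp add: r_def)
  qed
  ultimately show ?thesis using that by auto
qed

lemma local_sep_ge_powr:
  assumes "1 < d1" "0 < d2" "d2 - d1 < d1\<^sup>2"
    and \<alpha>: "\<alpha> = ((d1 - 1) * (d1\<^sup>2 - (d2 - d1))) / (d1\<^sup>2 * d2)"
  shows "\<exists>c>0. \<forall>v \<in> pverts G. \<forall>n. card (gball G v 1) \<le> n \<longrightarrow>
    ereal (c * real n powr \<alpha>) \<le> local_sep G v n"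
proof -
  define q where "q = (d1 - 1) / d1"
  \<comment> \<open>Makes the exponent of r in local_sep_ge_powr_radius equal to d2 * alpha.\<close>
  define u where "u = 1 / (d1 * (d1 + 1))"
  have q: "q \<ge> 0" using assms by (simp add: q_def)
  have pq: "1 - u - q = 1 / (d1 + 1)"
  proof -
    have "1 - q = 1 / d1" using assms(1) by (simp add: q_def diff_divide_distrib)
    moreover have "1 / d1 - 1 / (d1 * (d1 + 1)) = 1 / (d1 + 1)"
      using assms(1) by (simp add: divide_simps)
    ultimately show ?thesis by (simp add: u_def)
  qed
  have "0 < 1 - u - q" unfolding pq using assms(1) by simp
  then have u: "0 < u" "u < 1 - q" using assms(1) by (auto simp: u_def)
  have "1 - d2 * u = (d1 * (d1 + 1) - d2) / (d1 * (d1 + 1))"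
    using assms(1) by (simp add: u_def diff_divide_distrib)
  also have "d1 * (d1 + 1) - d2 = d1\<^sup>2 - (d2 - d1)"
    by (simp add: power2_eq_square algebra_simps)
  finally have "1 - d2 * u = (d1\<^sup>2 - (d2 - d1)) / (d1 * (d1 + 1))" .
  then have "q * (1 - d2 * u) / (1 - u - q) = q * ((d1\<^sup>2 - (d2 - d1)) / d1)"
    using assms(1) unfolding pq by simp
  also have "\<dots> = d2 * \<alpha>"
    using assms(1,2) by (simp add: q_def \<alpha> power2_eq_square)
  finally have expo: "q * (1 - d2 * u) / (1 - u - q) = d2 * \<alpha>" .
  have \<alpha>0: "\<alpha> \<ge> 0" using assms by simp
  obtain c where c: "c > 0" and sep: "\<And>v r n. v \<in> pverts G \<Longrightarrow> r \<ge> 1 \<Longrightarrow> card (gball G v r) \<le> n \<Longrightarrow>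
      ereal (c * real r powr (d2 * \<alpha>)) \<le> local_sep G v n"
    using local_sep_ge_powr_radius[OF q_def q u] unfolding expo by metis
  define K where "K = b powr \<alpha> * 2 powr (d2 * \<alpha>)"
  have K: "K > 0" using b by (simp add: K_def)
  show ?thesis
  proof (intro exI[of _ "c / K"] conjI ballI allI impI)
    show "c / K > 0" using c K by simp
    fix v n assume v: "v \<in> pverts G" and n: "card (gball G v 1) \<le> n"
    obtain r where r: "r \<ge> 1" "card (gball G v r) \<le> n" "n < card (gball G v (Suc r))"
      using radius_of_cardinality[OF v n] .
    have "real n \<le> real (card (gball G v (Suc r)))" using r(3) by simp
    also have "\<dots> \<le> b * real (Suc r) powr d2" using ball[OF v, of "Suc r"] by simp
    \<comment> \<open>The shift from \<open>r\<close> to \<open>Suc r\<close> is absorbed by the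
      factor 2, because \<open>r\<close> is at least 1.\<close>
    also have "\<dots> \<le> b * (2 * real r) powr d2"
      using b r(1) assms(2) by (intro mult_left_mono powr_mono2) auto
    finally have "real n powr \<alpha> \<le> (b * (2 * real r) powr d2) powr \<alpha>"
      using \<alpha>0 by (intro powr_mono2) auto
    also have "\<dots> = K * real r powr (d2 * \<alpha>)"
      using b by (simp add: K_def powr_mult powr_powr)
    finally have "c / K * real n powr \<alpha> \<le> c * real r powr (d2 * \<alpha>)"
      using c K by (simp add: field_simps)
    also have "ereal \<dots> \<le> local_sep G v n" using sep[OF v r(1,2)] .
    finally show "ereal (c / K * real n powr \<alpha>) \<le> local_sep G v n" by simp
  qed
qed

end

theorem theoremA21:
  fixes G :: "'a pair_pre_digraph" and d1 d2 \<alpha> :: real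
  assumes "pair_sym_digraph G"
    and "d1 > 0" and "d2 > 0"
    and "polynomial_graph d1 d2 (with_proj G)"
    and "d2 - d1 < d1\<^sup>2"
    and "\<alpha> = ((d1 - 1) * (d1\<^sup>2 - (d2 - d1))) / (d1\<^sup>2 * d2)"
  shows "(\<forall>\<eta>::real. 0 < \<eta> \<and> \<eta> < 1 \<longrightarrow>
            (\<exists>c>0. \<forall>v \<in> pverts G. \<forall>n::nat. card (gball (with_proj G) v 1) \<le> n \<longrightarrow>
               local_sep (with_proj G) v n \<ge> ereal (c * real n powr ((1 - \<eta>) * \<alpha>)))) \<and>
         (d1 = d2 \<longrightarrow>
            (\<exists>c>0. \<forall>v \<in> pverts G. \<forall>n::nat. card (gball (with_proj G) v 1) \<le> n \<longrightarrow>
               local_sep (with_proj G) v n \<ge> ereal (c * real n powr \<alpha>)))"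
proof -
  obtain b g where "isoperimetric_graph G b g d1 d2"
  proof -
    from assms(4) obtain b g where "b > 0" "g > 0"
      and "\<forall>v \<in> pverts G. \<forall>n::nat. n \<ge> 1 \<longrightarrow>
        finite (gball G v n) \<and> real (card (gball G v n)) \<le> b * real n powr d2"
      and "\<forall>V. V \<subseteq> pverts G \<and> finite V \<and> V \<noteq> {} \<longrightarrow>
        real (card (boundary G V)) \<ge> g * real (card V) powr ((d1 - 1) / d1)"
      by (auto simp: polynomial_graph_def)
    with assms(1,2) have "isoperimetric_graph G b g d1 d2"
      by (simp add: isoperimetric_graph_def)
    then show thesis by (rule that)
  qed
  then interpret isoperimetric_graph G b g d1 d2 .
  \<comment> \<open>Allowing \<eta> = 0 lets one statement serve both conjuncts.\<close>
  have main: "\<exists>c>0. \<forall>v \<in> pverts G. \<forall>n. card (gball (with_proj G) v 1) \<le> n \<longrightarrow>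
      local_sep (with_proj G) v n \<ge> ereal (c * real n powr ((1 - \<eta>) * \<alpha>))"
    if \<eta>: "0 \<le> \<eta>" "\<eta> < 1" for \<eta>
  proof (cases "1 < d1")
    case True
    then obtain c where c: "c > 0" and sep: "\<forall>v \<in> pverts G. \<forall>n. card (gball G v 1) \<le> n \<longrightarrow>
        ereal (c * real n powr \<alpha>) \<le> local_sep G v n"
      using local_sep_ge_powr[OF _ assms(3,5,6)] by blast
    have "\<alpha> \<ge> 0" using assms True by simp
    then have exps: "(1 - \<eta>) * \<alpha> \<le> \<alpha>" using \<eta> by (simp add: mult_left_le_one_le)
    have "ereal (c * real n powr ((1 - \<eta>) * \<alpha>)) \<le> local_sep G v n"
      if "v \<in> pverts G" "card (gball G v 1) \<le> n" for v n
    proof -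
      \<comment> \<open>For a base of at least 1, lowering the exponent from \<alpha> only weakens
        the bound.\<close>
      have "real n \<ge> 1" using card_gball_ge[OF that(1), of 1] that(2) by simp
      then have "c * real n powr ((1 - \<eta>) * \<alpha>) \<le> c * real n powr \<alpha>"
        using c exps by (intro mult_left_mono powr_mono) auto
      also have "ereal \<dots> \<le> local_sep G v n" using sep that by blast
      finally show ?thesis by simp
    qed
    with c show ?thesis by blast
  next
    case False
    then have "\<alpha> \<le> 0" using assms by (simp add: divide_nonpos_pos mult_nonpos_nonneg)
    then have exps: "(1 - \<eta>) * \<alpha> \<le> 0" using \<eta> by (simp add: mult_nonneg_nonpos)
    have "ereal (1 * real n powr ((1 - \<eta>) * \<alpha>)) \<le> local_sep G v n"
      if "v \<in> pverts G" "card (gball G v 1) \<le> n" for v n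
    proof -
      have "real n \<ge> 1" using card_gball_ge[OF that(1), of 1] that(2) by simp
      then have "real n powr ((1 - \<eta>) * \<alpha>) \<le> real n powr 0"
        using exps by (intro powr_mono) auto
      also have "\<dots> \<le> 1" by simp
      finally have "ereal (1 * real n powr ((1 - \<eta>) * \<alpha>)) \<le> 1" by simp
      also have "\<dots> \<le> local_sep G v n" using local_sep_ge_1[OF that] .
      finally show ?thesis .
    qed
    then show ?thesis by (intro exI[of _ 1]) auto
  qed
  show ?thesis using main[of 0] main by auto
qed

end
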